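(* Let $k>0$ (sound speed) and $m>0$ (black hole mass). For any radius $r_0>0$, density $\rho_0>0$ and velocity $v_0\ge0$ with $v_0\ne k$, there exists a unique (smooth) steady state solution $\rho=\rho(r;r_0,\rho_0,v_0)$, $v=v(r;r_0,\rho_0,v_0)$ of the system $$\frac{d}{dr}(r^2\rho v)=0,\qquad \frac{d}{dr}\Big(r^2\rho(v^2+k^2)\Big)-2k^2r\rho+m\rho=0$$ satisfying $\rho(r_0)=\rho_0$ and $v(r_0)=v_0$. Moreover $\mathrm{sgn}(v(r)-k)=\mathrm{sgn}(v_0-k)$ for all $r$ in the domain of the solution, and this domain is as follows. 1. (Regime without sonic point.) If $P(r_0,v_0)>0$, the solution is defined on the whole interval $(0,+\infty)$. 2. (Regime with sonic points.) If $P(r_0,v_0)\le0$, the solution is defined on the interval $\Xi\subsetneq(0,+\infty)$ given by $$\Xi=\begin{cases}(0,\underline r_* ),& r_0\le\frac{m}{2k^2},\\ (\overline r_*,+\infty),& r_0>\frac{m}{2k^2},\end{cases}$$ where $\underline r_*\le\overline r_*$ are the two sonic points; moreover $v(r)\to k$ when $r$ approaches the sonic point bounding $\Xi$.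
   Context: The system is the steady version of the non-relativistic Euler model on a Schwarzschild background, $\partial_t(r^2\rho)+\partial_r(r^2\rho v)=0$, $\partial_t(r^2\rho v)+\partial_r(r^2\rho(v^2+k^2))-2k^2r\rho+m\rho=0$, with $r>0$, $\rho>0$. For $r_0>0$, $v_0>0$, $$P(r_0,v_0)=\frac32+\ln\frac{m^2}{4k^3r_0^2v_0}+\frac{1}{2k^2}\Big(v_0^2-\frac{2m}{r_0}\Big),$$ with the convention $P(r_0,0)=+\infty$. A sonic point is a radius $r>0$ solving $$\frac12(k^2-v_0^2)+k^2\ln\frac{v_0}{k}-k^2\ln\frac{r^2}{r_0^2}-\frac mr+\frac m{r_0}=0 .$$ When $v_0>0$, $v_0\ne k$ and $P(r_0,v_0)\le0$ there are two (possibly coinciding) sonic points $\underline r_*\le\overline r_*$.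
   Formalization: When P(r_0,v_0)=0 the sonic points coincide and the solution extends smoothly through v=k, so there Ξ is proved to be the maximal domain only among solutions with v≠k; for P≠0 the domain is maximal among all smooth solutions. *)

theory Defs
  imports "HOL-Analysis.Analysis"
begin

text \<open>C-infinity smoothness; the iterated derivatives are two-sided, so this is meant for
  open \<open>S\<close> only.\<close>

definition smooth_on_open :: "real set \<Rightarrow> (real \<Rightarrow> real) \<Rightarrow> bool" where
  "smooth_on_open S f \<longleftrightarrow> (\<forall>n. \<forall>x\<in>S. (deriv ^^ n) f differentiable (at x))"

text \<open>Smooth solutions with positive density on an open interval \<open>I\<close> around \<open>r0\<close>. The functions
  are total; only their values on \<open>I\<close> matter. The velocity is not assumed to avoid the sound
  speed, nor to have a sign. In the degenerate case \<open>P = 0\<close>, where the two sonic points coincide,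
  there are therefore also smooth solutions running through the sonic point and changing the sign of
  \<open>v - k\<close>; there the domain can only be maximal among solutions with \<open>v \<noteq> k\<close>.\<close>

definition steady_solution ::
  "real \<Rightarrow> real \<Rightarrow> real \<Rightarrow> real \<Rightarrow> real \<Rightarrow> real set \<Rightarrow> (real \<Rightarrow> real) \<Rightarrow> (real \<Rightarrow> real) \<Rightarrow> bool" where
  "steady_solution k m r0 \<rho>0 v0 I \<rho> v \<longleftrightarrow>
     open I \<and> is_interval I \<and> I \<subseteq> {0<..} \<and> r0 \<in> I \<and>
     smooth_on_open I \<rho> \<and> smooth_on_open I v \<and>
     (\<forall>r\<in>I. \<rho> r > 0) \<and>
     (\<forall>r\<in>I. deriv (\<lambda>s. s\<^sup>2 * \<rho> s * v s) r = 0) \<and>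
     (\<forall>r\<in>I. deriv (\<lambda>s. s\<^sup>2 * \<rho> s * ((v s)\<^sup>2 + k\<^sup>2)) r - 2 * k\<^sup>2 * r * \<rho> r + m * \<rho> r = 0) \<and>
     \<rho> r0 = \<rho>0 \<and> v r0 = v0"

text \<open>Extended-real valued because of the convention \<open>P(r0, 0) = +\<infinity>\<close>.\<close>

definition P :: "real \<Rightarrow> real \<Rightarrow> real \<Rightarrow> real \<Rightarrow> ereal" where
  "P k m r0 v0 =
     (if v0 = 0 then \<infinity>
      else ereal (3 / 2 + ln (m\<^sup>2 / (4 * k ^ 3 * r0\<^sup>2 * v0))
                  + 1 / (2 * k\<^sup>2) * (v0\<^sup>2 - 2 * m / r0)))"

definition sonic_points :: "real \<Rightarrow> real \<Rightarrow> real \<Rightarrow> real \<Rightarrow> real set" where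
  "sonic_points k m r0 v0 =
     {r. r > 0 \<and>
         1 / 2 * (k\<^sup>2 - v0\<^sup>2) + k\<^sup>2 * ln (v0 / k) - k\<^sup>2 * ln (r\<^sup>2 / r0\<^sup>2) - m / r + m / r0 = 0}"

definition sonic_domain :: "real \<Rightarrow> real \<Rightarrow> real \<Rightarrow> real \<Rightarrow> real \<Rightarrow> real set" where
  "sonic_domain k m r0 rlo rhi = (if r0 \<le> m / (2 * k\<^sup>2) then {0<..<rlo} else {rhi<..})"

end

theory Submission
  imports Defs "HOL-Real_Asymp.Real_Asymp"
begin

text \<open>
  The system has two first integrals, the mass flux \<open>r\<^sup>2 \<rho> v\<close> and the Bernoulli function
  \<open>v\<^sup>2 / 2 + k\<^sup>2 ln \<rho> - m / r\<close>. If \<open>v0 = 0\<close>, the first one forces \<open>v = 0\<close> and the second one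
  gives \<open>\<rho>\<close> explicitly. If \<open>v0 > 0\<close>, then \<open>v\<close> stays positive, the flux expresses \<open>\<rho>\<close> by \<open>v\<close>,
  and what remains of the Bernoulli law is a scalar equation with separated variables,
  \<open>kinetic v = kinetic v0 + potential r - potential r0\<close>, where \<open>kinetic v = v\<^sup>2 / 2 - k\<^sup>2 ln v\<close>
  and \<open>potential r = 2 k\<^sup>2 ln r + m / r\<close>.

  Both functions are wells on the positive half-line: they decrease strictly to a single minimum,
  at \<open>v = k\<close> and at \<open>r = m / (2 k\<^sup>2)\<close>, increase strictly after it, and tend to infinity at both
  ends. The equation is therefore solvable for \<open>v\<close> exactly where its right-hand side is at least
  \<open>kinetic k\<close>, that is, where \<open>potential\<close> is at least a certain \<open>sonic_level\<close>. Above that level there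
  is one root on each side of \<open>k\<close>, a smooth function of \<open>r\<close>; a solution takes its values on the
  side of \<open>v0\<close> because a continuous function cannot pass to the other side without meeting \<open>k\<close>.
  The sonic points are the points where \<open>potential\<close> equals \<open>sonic_level\<close>, and \<open>k\<^sup>2 P\<close> is the
  minimum of \<open>potential\<close> minus \<open>sonic_level\<close>. So \<open>P > 0\<close> puts the whole half-line above the
  level, while for \<open>P \<le> 0\<close> the part above the level is the complement of the interval between the
  two sonic points, and the flow lives in the component of \<open>r0\<close>.

  Just beyond the sonic point next to \<open>r0\<close>, \<open>potential\<close> falls below \<open>sonic_level\<close> if \<open>P < 0\<close>, so that no
  solution can be continued there. If \<open>P = 0\<close> the two sonic points coincide and only a solution
  with \<open>v \<noteq> k\<close> is prevented from reaching them.
\<close>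

section \<open>Functions with a single well\<close>

text \<open>This is used twice: for the kinetic term, whose two monotone branches are the subsonic and the
  supersonic velocities, and for the potential term, whose level sets are the sonic points.\<close>

locale potential_well =
  fixes f f' :: "real \<Rightarrow> real" and c :: real
  assumes c_pos: "c > 0"
    and deriv: "\<And>x. x > 0 \<Longrightarrow> (f has_real_derivative f' x) (at x)"
    and deriv_neg: "\<And>x. 0 < x \<Longrightarrow> x < c \<Longrightarrow> f' x < 0"
    and deriv_pos: "\<And>x. c < x \<Longrightarrow> f' x > 0"
    and at_zero: "filterlim f at_top (at_right 0)"
    and at_infinity: "filterlim f at_top at_top"
begin

lemma continuous_on_pos: "S \<subseteq> {0<..} \<Longrightarrow> continuous_on S f"
  by (rule continuous_on_subset[OF DERIV_continuous_on[of "{0<..}" f f']])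
     (auto intro: DERIV_subset deriv)

lemma strictly_decreasing:
  assumes "0 < x" "x < y" "y \<le> c" shows "f y < f x"
  by (rule DERIV_neg_imp_decreasing_open[OF \<open>x < y\<close>])
     (use assms in \<open>auto intro!: continuous_on_pos exI conjI deriv deriv_neg\<close>)

lemma strictly_increasing:
  assumes "c \<le> x" "x < y" shows "f x < f y"
  by (rule DERIV_pos_imp_increasing_open[OF \<open>x < y\<close>])
     (use assms c_pos in \<open>auto intro!: continuous_on_pos exI conjI deriv deriv_pos\<close>)

lemma above_minimum: "x > 0 \<Longrightarrow> x \<noteq> c \<Longrightarrow> f c < f x"
  using strictly_decreasing[of x c] strictly_increasing[of c x] by (cases "x < c") auto

lemma minimum: "x > 0 \<Longrightarrow> f c \<le> f x"
  using above_minimum[of x] by (cases "x = c") auto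

lemma left_root:
  assumes "f c \<le> y" obtains x where "0 < x" "x \<le> c" "f x = y"
proof -
  have "eventually (\<lambda>x. y \<le> f x) (at_right 0)"
    using at_zero by (simp add: filterlim_at_top)
  moreover have "eventually (\<lambda>x. x \<in> {0<..<c}) (at_right 0)"
    by (rule eventually_at_right_real[OF c_pos])
  ultimately have "eventually (\<lambda>x. y \<le> f x \<and> x \<in> {0<..<c}) (at_right 0)"
    by eventually_elim simp
  then obtain x where x: "y \<le> f x" "0 < x" "x < c"
    by (auto dest!: eventually_happens simp: trivial_limit_at_right_real)
  have "continuous_on {x..c} f" by (rule continuous_on_pos) (use x in auto)
  then obtain z where "x \<le> z" "z \<le> c" "f z = y"
    using IVT2'[of f c y x] x assms by auto
  then show ?thesis using that[of z] x by simp
qed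

lemma right_root:
  assumes "f c \<le> y" obtains x where "c \<le> x" "f x = y"
proof -
  have "eventually (\<lambda>x. y \<le> f x) at_top"
    using at_infinity by (simp add: filterlim_at_top)
  then obtain x where x: "y \<le> f x" "x > c"
    using eventually_conj[OF _ eventually_gt_at_top[of c]]
    by (metis (mono_tags, lifting) eventually_happens trivial_limit_at_top_linorder)
  have "continuous_on {c..x} f" by (rule continuous_on_pos) (use c_pos in auto)
  then obtain z where "c \<le> z" "z \<le> x" "f z = y"
    using IVT'[of f c y x] x assms by auto
  then show ?thesis using that[of z] by simp
qed

lemma level_set:
  assumes "f c \<le> y"
  obtains a b where "0 < a" "a \<le> c" "c \<le> b" "f a = y" "f b = y"
    "\<And>x. x > 0 \<Longrightarrow> y < f x \<longleftrightarrow> x < a \<or> b < x"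
    "\<And>x. a < x \<Longrightarrow> x < b \<Longrightarrow> f x < y"
proof -
  obtain a where a: "0 < a" "a \<le> c" "f a = y" using left_root assms by blast
  obtain b where b: "c \<le> b" "f b = y" using right_root assms by blast
  have in_left: "y < f x" if "0 < x" "x < a" for x
    using strictly_decreasing[of x a] that a by auto
  have in_right: "y < f x" if "b < x" for x
    using strictly_increasing[of b x] that b by auto
  have inside: "f x < y" if "a < x" "x < b" for x
  proof (cases "x \<le> c")
    case True
    then show ?thesis using strictly_decreasing[of a x] that a by auto
  next
    case False
    then show ?thesis using strictly_increasing[of x b] that b by auto
  qed
  have "y < f x \<longleftrightarrow> x < a \<or> b < x" if "x > 0" for x
    using in_left[of x] in_right[of x] inside[of x] that a b
    by (metis less_irrefl linorder_cases not_less_iff_gr_or_eq)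
  then show ?thesis using that a b inside by blast
qed

text \<open>Since the minimum is strict and the function is monotone on each side of it, values close to the
  minimal value are attained only close to the minimum point. This gives the limit of the
  velocity at a sonic point, a level that is not covered by the derivative of the branches.\<close>

lemma tendsto_minimum:
  assumes lim: "((\<lambda>x. f (u x)) \<longlongrightarrow> f c) F" and pos: "eventually (\<lambda>x. u x > 0) F"
  shows "(u \<longlongrightarrow> c) F"
proof (rule order_tendstoI)
  fix a assume "a < c"
  define a' where "a' = max a (c / 2)"
  have a': "a \<le> a'" "0 < a'" "a' < c" using \<open>a < c\<close> c_pos by (auto simp: a'_def)
  have "eventually (\<lambda>x. f (u x) < f a') F"
    using order_tendstoD(2)[OF lim] above_minimum[of a'] a' by auto
  with pos show "eventually (\<lambda>x. a < u x) F"
  proof eventually_elim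
    case (elim x)
    have "\<not> u x \<le> a'"
    proof
      assume "u x \<le> a'"
      then have "f a' \<le> f (u x)"
        using strictly_decreasing[of "u x" a'] elim a' by (cases "u x = a'") auto
      with elim show False by simp
    qed
    then show ?case using a' by simp
  qed
next
  fix a assume "c < a"
  have "eventually (\<lambda>x. f (u x) < f a) F"
    using order_tendstoD(2)[OF lim] above_minimum[of a] c_pos \<open>c < a\<close> by auto
  then show "eventually (\<lambda>x. u x < a) F"
  proof eventually_elim
    case (elim x)
    show ?case
    proof (rule ccontr)
      assume "\<not> u x < a"
      then have "f a \<le> f (u x)"
        using strictly_increasing[of a "u x"] \<open>c < a\<close> by (cases "u x = a") auto
      with elim show False by simp
    qed
  qed
qed

text \<open>Stated with \<open>sgn\<close> so that both branches are treated at once, in the form in which the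
  preservation of the sign of \<open>v - k\<close> is claimed.\<close>

definition side :: "real \<Rightarrow> real set" where
  "side x0 = {x. x > 0 \<and> sgn (x - c) = sgn (x0 - c)}"

lemma side_eq: "x0 \<noteq> c \<Longrightarrow> side x0 = (if x0 < c then {0<..<c} else {c<..})"
  using c_pos by (auto simp: side_def sgn_if split: if_splits)

lemma inj_on_side: "x0 \<noteq> c \<Longrightarrow> inj_on f (side x0)"
proof (rule linorder_inj_onI')
  fix x y assume "x0 \<noteq> c" "x \<in> side x0" "y \<in> side x0" "x < y"
  then show "f x \<noteq> f y"
    using strictly_decreasing[of x y] strictly_increasing[of x y]
    by (auto simp: side_eq split: if_splits)
qed

lemma image_side: "x0 \<noteq> c \<Longrightarrow> f ` side x0 = {f c<..}"
proof (intro equalityI subsetI)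
  fix y assume "x0 \<noteq> c" "y \<in> f ` side x0"
  then show "y \<in> {f c<..}"
    using c_pos by (auto simp: side_eq intro!: above_minimum split: if_splits)
next
  fix y assume "x0 \<noteq> c" "y \<in> {f c<..}"
  then have y: "f c \<le> y" "y \<noteq> f c" by auto
  obtain a where a: "0 < a" "a \<le> c" "f a = y" using left_root y by blast
  obtain b where b: "c \<le> b" "f b = y" using right_root y by blast
  have "a \<noteq> c" "b \<noteq> c" using a b y by auto
  then show "y \<in> f ` side x0"
    using a b image_eqI[of y f a "side x0"] image_eqI[of y f b "side x0"]
    by (cases "x0 < c") (auto simp: side_eq[OF \<open>x0 \<noteq> c\<close>])
qed

definition branch :: "real \<Rightarrow> real \<Rightarrow> real" where
  "branch x0 = inv_into (side x0) f"

lemma branch_in_side: "x0 \<noteq> c \<Longrightarrow> f c < y \<Longrightarrow> branch x0 y \<in> side x0"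
  unfolding branch_def by (rule inv_into_into) (simp add: image_side)

lemma f_branch: "x0 \<noteq> c \<Longrightarrow> f c < y \<Longrightarrow> f (branch x0 y) = y"
  unfolding branch_def by (rule f_inv_into_f) (simp add: image_side)

lemma branch_f: "x0 \<noteq> c \<Longrightarrow> x \<in> side x0 \<Longrightarrow> branch x0 (f x) = x"
  unfolding branch_def by (rule inv_into_f_f) (simp_all add: inj_on_side)

lemma deriv_nonzero: "x > 0 \<Longrightarrow> x \<noteq> c \<Longrightarrow> f' x \<noteq> 0"
  using deriv_neg[of x] deriv_pos[of x] by (cases "x < c") auto

text \<open>The derivative vanishes only at the minimum, which lies on neither open side, so the inverse
  function theorem applies at every level above the minimal one.\<close>

lemma branch_deriv:
  assumes "x0 \<noteq> c" "f c < y"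
  shows "(branch x0 has_real_derivative inverse (f' (branch x0 y))) (at y)"
proof -
  let ?x = "branch x0 y"
  have x: "?x \<in> side x0" "?x > 0" "?x \<noteq> c"
    using branch_in_side[OF assms] \<open>x0 \<noteq> c\<close> by (auto simp: side_def sgn_if split: if_splits)
  have "open (side x0)" using \<open>x0 \<noteq> c\<close> by (simp add: side_eq)
  moreover have "side x0 \<subseteq> {0<..}" by (auto simp: side_def)
  moreover have "(f has_derivative (*) (f' ?x)) (at ?x)"
    using deriv[OF x(2)] by (simp add: has_field_derivative_def)
  moreover have "(*) (f' ?x) \<circ> (*) (inverse (f' ?x)) = id"
    using deriv_nonzero[OF x(2,3)] by (auto simp: fun_eq_iff)
  ultimately have "(branch x0 has_derivative (*) (inverse (f' ?x))) (at (f ?x))"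
    using x(1) by (intro has_derivative_inverse_strong[of "side x0" ?x f])
      (auto intro: continuous_on_pos branch_f[OF \<open>x0 \<noteq> c\<close>])
  then show ?thesis
    using f_branch[OF assms] by (simp add: has_field_derivative_def)
qed

end

section \<open>Smoothness of solutions of rational differential equations\<close>

text \<open>Smoothness is obtained without computing higher derivatives. If \<open>f'\<close> is a rational expression in
  \<open>x\<close> and \<open>f\<close>, then the rational expressions in \<open>x\<close> and \<open>f\<close> form a class that is closed under
  differentiation, and all members of such a class are smooth.\<close>

inductive rational_in :: "real set \<Rightarrow> (real \<Rightarrow> real) \<Rightarrow> (real \<Rightarrow> real) \<Rightarrow> bool"
  for S f where
  const: "rational_in S f (\<lambda>x. a)"
| ident: "rational_in S f (\<lambda>x. x)"
| gen: "rational_in S f f"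
| add: "rational_in S f g \<Longrightarrow> rational_in S f h \<Longrightarrow> rational_in S f (\<lambda>x. g x + h x)"
| mult: "rational_in S f g \<Longrightarrow> rational_in S f h \<Longrightarrow> rational_in S f (\<lambda>x. g x * h x)"
| inverse: "rational_in S f g \<Longrightarrow> \<forall>x\<in>S. g x \<noteq> 0 \<Longrightarrow> rational_in S f (\<lambda>x. inverse (g x))"

text \<open>The induction on the order of the derivative is over functions that agree on \<open>S\<close> with a member of
  the class, because \<open>deriv\<close> of a member is known only on \<open>S\<close>; openness of \<open>S\<close> makes that
  enough to differentiate again.\<close>

lemma smooth_on_open_closed_class:
  assumes "open S"
    and step: "\<And>g. A g \<Longrightarrow> \<exists>g'. A g' \<and> (\<forall>x\<in>S. (g has_real_derivative g' x) (at x))"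
    and "A g"
  shows "smooth_on_open S g"
proof -
  have "\<forall>x\<in>S. (deriv ^^ n) h differentiable (at x)" if "A g" "\<forall>x\<in>S. h x = g x" for n g h
    using that
  proof (induction n arbitrary: g h)
    case (Suc n)
    obtain g' where g': "A g'" "\<forall>x\<in>S. (g has_real_derivative g' x) (at x)"
      using step Suc.prems by blast
    have "deriv h x = g' x" if "x \<in> S" for x
    proof (rule DERIV_imp_deriv)
      show "(h has_real_derivative g' x) (at x)"
        using has_field_derivative_transform_within_open[of g "g' x" x S h] g' that Suc.prems
          \<open>open S\<close> by auto
    qed
    then show ?case
      using Suc.IH[OF g'(1), of "deriv h"] by (simp add: funpow_swap1)
  next
    case 0
    obtain g' where g': "A g'" "\<forall>x\<in>S. (g has_real_derivative g' x) (at x)"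
      using step 0 by blast
    have "(h has_real_derivative g' x) (at x)" if "x \<in> S" for x
      using has_field_derivative_transform_within_open[of g "g' x" x S h] g' that 0
          \<open>open S\<close> by auto
    then show ?case by (auto simp: real_differentiable_def)
  qed
  then show ?thesis using \<open>A g\<close> by (auto simp: smooth_on_open_def)
qed

lemma smooth_on_open_rational:
  assumes "open S" and f': "rational_in S f f'"
    and deriv: "\<And>x. x \<in> S \<Longrightarrow> (f has_real_derivative f' x) (at x)"
    and g: "rational_in S f g"
  shows "smooth_on_open S g"
proof (rule smooth_on_open_closed_class[where A = "rational_in S f", OF \<open>open S\<close> _ g])
  fix g assume "rational_in S f g"
  then show "\<exists>g'. rational_in S f g' \<and> (\<forall>x\<in>S. (g has_real_derivative g' x) (at x))"
  proof induction
    case (const a)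
    show ?case by (intro exI[of _ "\<lambda>x. 0"] conjI rational_in.const) auto
  next
    case ident
    show ?case by (intro exI[of _ "\<lambda>x. 1"] conjI rational_in.const) auto
  next
    case gen
    show ?case using f' deriv by blast
  next
    case (add g h)
    then obtain g' h' where
      "rational_in S f g'" "\<forall>x\<in>S. (g has_real_derivative g' x) (at x)"
      "rational_in S f h'" "\<forall>x\<in>S. (h has_real_derivative h' x) (at x)" by blast
    then show ?case
      by (intro exI[of _ "\<lambda>x. g' x + h' x"]) (auto intro: rational_in.intros DERIV_add)
  next
    case (mult g h)
    then obtain g' h' where
      "rational_in S f g'" "\<forall>x\<in>S. (g has_real_derivative g' x) (at x)"
      "rational_in S f h'" "\<forall>x\<in>S. (h has_real_derivative h' x) (at x)" by blast
    then show ?case using mult.hyps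
      by (intro exI[of _ "\<lambda>x. g' x * h x + h' x * g x"])
         (auto intro!: rational_in.add rational_in.mult DERIV_mult)
  next
    case (inverse g)
    then obtain g' where
      g': "rational_in S f g'" "\<forall>x\<in>S. (g has_real_derivative g' x) (at x)" by blast
    have "((\<lambda>x. inverse (g x)) has_real_derivative
            (-1) * (inverse (g x) * g' x * inverse (g x))) (at x)" if "x \<in> S" for x
      using DERIV_inverse'[of g "g' x" x UNIV] g' that inverse.hyps by simp
    moreover have "rational_in S f (\<lambda>x. (-1) * (inverse (g x) * g' x * inverse (g x)))"
      using inverse.hyps
      by (intro rational_in.mult rational_in.const rational_in.inverse g'(1))
    ultimately show ?case by blast
  qed
qed

section \<open>First integrals of the steady Euler system\<close>

definition kinetic :: "real \<Rightarrow> real \<Rightarrow> real" where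
  "kinetic k v = v\<^sup>2 / 2 - k\<^sup>2 * ln v"

definition potential :: "real \<Rightarrow> real \<Rightarrow> real \<Rightarrow> real" where
  "potential k m r = 2 * k\<^sup>2 * ln r + m / r"

lemma kinetic_well:
  assumes "k > 0" shows "potential_well (kinetic k) (\<lambda>v. v - k\<^sup>2 / v) k"
proof
  show "k > 0" by fact
  show "(kinetic k has_real_derivative v - k\<^sup>2 / v) (at v)" if "v > 0" for v
    unfolding kinetic_def[abs_def] using that by (auto intro!: derivative_eq_intros)
  show "v - k\<^sup>2 / v < 0" if "0 < v" "v < k" for v
    using that mult_strict_mono[of v k v k] by (simp add: field_simps power2_eq_square)
  show "v - k\<^sup>2 / v > 0" if "k < v" for v
    using that assms mult_strict_mono[of k v k v] by (simp add: field_simps power2_eq_square)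
  show "filterlim (kinetic k) at_top (at_right 0)" "filterlim (kinetic k) at_top at_top"
    unfolding kinetic_def[abs_def] using assms by real_asymp+
qed

lemma potential_deriv:
  "r > 0 \<Longrightarrow> (potential k m has_real_derivative 2 * k\<^sup>2 / r - m / r\<^sup>2) (at r)"
  unfolding potential_def[abs_def]
  by (auto intro!: derivative_eq_intros simp: power2_eq_square field_simps)

lemma potential_well_potential:
  assumes "k > 0" "m > 0"
  shows "potential_well (potential k m) (\<lambda>r. 2 * k\<^sup>2 / r - m / r\<^sup>2) (m / (2 * k\<^sup>2))"
proof
  have eq: "2 * k\<^sup>2 / r - m / r\<^sup>2 = 2 * k\<^sup>2 / r\<^sup>2 * (r - m / (2 * k\<^sup>2))" if "r > 0" for r
    using that assms by (simp add: field_simps power2_eq_square)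
  show pos: "m / (2 * k\<^sup>2) > 0" using assms by simp
  show "2 * k\<^sup>2 / r - m / r\<^sup>2 < 0" if "0 < r" "r < m / (2 * k\<^sup>2)" for r
    unfolding eq[OF that(1)] using that assms by (intro mult_pos_neg) auto
  show "2 * k\<^sup>2 / r - m / r\<^sup>2 > 0" if "m / (2 * k\<^sup>2) < r" for r
  proof -
    have "r > 0" using that pos by linarith
    then show ?thesis unfolding eq[OF \<open>r > 0\<close>] using that assms by (intro mult_pos_pos) auto
  qed
  show "filterlim (potential k m) at_top (at_right 0)" "filterlim (potential k m) at_top at_top"
    unfolding potential_def[abs_def] using assms by real_asymp+
qed (rule potential_deriv)

text \<open>The derivative of the momentum flux is arranged so that the derivative of the mass flux
  appears as a factor and the geometric source \<open>2 k\<^sup>2 r \<rho>\<close> is split off. Once mass is conserved,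
  the momentum balance is then \<open>v v' + k\<^sup>2 \<rho>' / \<rho> + m / r\<^sup>2 = 0\<close>.\<close>

lemma flux_derivs:
  assumes "(\<sigma> has_real_derivative a) (at r)" "(w has_real_derivative b) (at r)"
  shows "((\<lambda>s. s\<^sup>2 * \<sigma> s * w s) has_real_derivative
           2 * r * \<sigma> r * w r + r\<^sup>2 * a * w r + r\<^sup>2 * \<sigma> r * b) (at r)"
    and "((\<lambda>s. s\<^sup>2 * \<sigma> s * ((w s)\<^sup>2 + k\<^sup>2)) has_real_derivative
           (2 * r * \<sigma> r * w r + r\<^sup>2 * a * w r + r\<^sup>2 * \<sigma> r * b) * w r
           + r\<^sup>2 * (\<sigma> r * w r * b + k\<^sup>2 * a) + 2 * k\<^sup>2 * r * \<sigma> r) (at r)"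
  using assms by (auto intro!: derivative_eq_intros simp: algebra_simps power2_eq_square)

lemma constant_on_interval:
  fixes f :: "real \<Rightarrow> real"
  assumes "is_interval J" "x \<in> J" "y \<in> J"
    and "\<And>s. s \<in> J \<Longrightarrow> (f has_real_derivative 0) (at s)"
  shows "f x = f y"
proof -
  have "\<exists>c. \<forall>x\<in>J. f x = c"
    using assms by (intro has_field_derivative_zero_constant)
      (auto simp: is_interval_convex_1 intro: DERIV_subset)
  with assms show ?thesis by auto
qed

text \<open>Once mass is conserved, the momentum balance divided by \<open>r\<^sup>2 \<rho>\<close> is the derivative of the Bernoulli function.\<close>

lemma first_integrals:
  assumes sol: "steady_solution k m r0 \<rho>0 v0 J \<sigma> w" and "r \<in> J"
  shows mass_flux_eq: "r\<^sup>2 * \<sigma> r * w r = r0\<^sup>2 * \<rho>0 * v0"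
    and bernoulli_eq: "(w r)\<^sup>2 / 2 + k\<^sup>2 * ln (\<sigma> r) - m / r = v0\<^sup>2 / 2 + k\<^sup>2 * ln \<rho>0 - m / r0"
proof -
  note sol' = sol[unfolded steady_solution_def]
  have J: "is_interval J" "r0 \<in> J" and init: "\<sigma> r0 = \<rho>0" "w r0 = v0" using sol' by auto
  have pos: "s > 0" "\<sigma> s > 0" if "s \<in> J" for s using sol' that by auto
  have D: "(\<sigma> has_real_derivative deriv \<sigma> s) (at s)" "(w has_real_derivative deriv w s) (at s)"
    if "s \<in> J" for s
  proof -
    have "(deriv ^^ 0) \<sigma> differentiable (at s)" "(deriv ^^ 0) w differentiable (at s)"
      using sol' that unfolding smooth_on_open_def by blast+
    then show "(\<sigma> has_real_derivative deriv \<sigma> s) (at s)"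
        "(w has_real_derivative deriv w s) (at s)"
      by (auto simp: DERIV_deriv_iff_real_differentiable)
  qed
  have mass: "2 * s * \<sigma> s * w s + s\<^sup>2 * deriv \<sigma> s * w s + s\<^sup>2 * \<sigma> s * deriv w s = 0"
    if "s \<in> J" for s
    using DERIV_imp_deriv[OF flux_derivs(1)[OF D[OF that]]] sol' that by auto
  have momentum: "s\<^sup>2 * (\<sigma> s * w s * deriv w s + k\<^sup>2 * deriv \<sigma> s) + m * \<sigma> s = 0"
    if "s \<in> J" for s
    using DERIV_imp_deriv[OF flux_derivs(2)[OF D[OF that]], of k] mass[OF that] sol' that by auto
  have "r\<^sup>2 * \<sigma> r * w r = r0\<^sup>2 * \<sigma> r0 * w r0"
  proof (rule constant_on_interval[of J, OF J(1) \<open>r \<in> J\<close> J(2)])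
    show "((\<lambda>s. s\<^sup>2 * \<sigma> s * w s) has_real_derivative 0) (at s)" if "s \<in> J" for s
      using flux_derivs(1)[OF D[OF that]] mass[OF that] by simp
  qed
  then show "r\<^sup>2 * \<sigma> r * w r = r0\<^sup>2 * \<rho>0 * v0" by (simp add: init)
  have "(w r)\<^sup>2 / 2 + k\<^sup>2 * ln (\<sigma> r) - m / r = (w r0)\<^sup>2 / 2 + k\<^sup>2 * ln (\<sigma> r0) - m / r0"
  proof (rule constant_on_interval[of J, OF J(1) \<open>r \<in> J\<close> J(2)])
    fix s assume s: "s \<in> J"
    have "((\<lambda>s. (w s)\<^sup>2 / 2 + k\<^sup>2 * ln (\<sigma> s) - m / s) has_real_derivative
        w s * deriv w s + k\<^sup>2 * (deriv \<sigma> s / \<sigma> s) + m / s\<^sup>2) (at s)"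
      using D[OF s] pos[OF s]
      by (auto intro!: derivative_eq_intros simp: power2_eq_square field_simps)
    moreover have "w s * deriv w s + k\<^sup>2 * (deriv \<sigma> s / \<sigma> s) + m / s\<^sup>2 =
        (s\<^sup>2 * (\<sigma> s * w s * deriv w s + k\<^sup>2 * deriv \<sigma> s) + m * \<sigma> s) / (s\<^sup>2 * \<sigma> s)"
      using pos[OF s] by (simp add: field_simps)
    ultimately show "((\<lambda>s. (w s)\<^sup>2 / 2 + k\<^sup>2 * ln (\<sigma> s) - m / s) has_real_derivative 0) (at s)"
      using momentum[OF s] by simp
  qed
  then show "(w r)\<^sup>2 / 2 + k\<^sup>2 * ln (\<sigma> r) - m / r = v0\<^sup>2 / 2 + k\<^sup>2 * ln \<rho>0 - m / r0"
    by (simp add: init)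
qed

text \<open>Converse direction. With the logarithmic derivative \<open>l\<close> of the density both equations
  lose the factor \<open>\<rho>\<close> and become linear in \<open>l\<close> and \<open>v'\<close>, which is how the explicit solutions are
  verified.\<close>

lemma steady_solutionI:
  assumes I: "open I" "is_interval I" "I \<subseteq> {0<..}" "r0 \<in> I"
    and smooth: "smooth_on_open I \<rho>" "smooth_on_open I v"
    and pos: "\<And>r. r \<in> I \<Longrightarrow> \<rho> r > 0"
    and \<rho>': "\<And>r. r \<in> I \<Longrightarrow> (\<rho> has_real_derivative \<rho> r * l r) (at r)"
    and v': "\<And>r. r \<in> I \<Longrightarrow> (v has_real_derivative v' r) (at r)"
    and mass: "\<And>r. r \<in> I \<Longrightarrow> v r * (2 / r + l r) + v' r = 0"
    and momentum: "\<And>r. r \<in> I \<Longrightarrow> v r * v' r + k\<^sup>2 * l r + m / r\<^sup>2 = 0"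
    and init: "\<rho> r0 = \<rho>0" "v r0 = v0"
  shows "steady_solution k m r0 \<rho>0 v0 I \<rho> v"
proof -
  have "deriv (\<lambda>s. s\<^sup>2 * \<rho> s * v s) r = 0 \<and>
    deriv (\<lambda>s. s\<^sup>2 * \<rho> s * ((v s)\<^sup>2 + k\<^sup>2)) r - 2 * k\<^sup>2 * r * \<rho> r + m * \<rho> r = 0" if r: "r \<in> I" for r
  proof -
    have "r > 0" using r I by auto
    have "2 * r * \<rho> r * v r + r\<^sup>2 * (\<rho> r * l r) * v r + r\<^sup>2 * \<rho> r * v' r
        = r\<^sup>2 * \<rho> r * (v r * (2 / r + l r) + v' r)"
      using \<open>r > 0\<close> by (simp add: field_simps power2_eq_square)
    then have mass0: "2 * r * \<rho> r * v r + r\<^sup>2 * (\<rho> r * l r) * v r + r\<^sup>2 * \<rho> r * v' r = 0"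
      using mass[OF r] by simp
    have "r\<^sup>2 * (\<rho> r * v r * v' r + k\<^sup>2 * (\<rho> r * l r)) + m * \<rho> r
        = r\<^sup>2 * \<rho> r * (v r * v' r + k\<^sup>2 * l r + m / r\<^sup>2)"
      using \<open>r > 0\<close> by (simp add: field_simps power2_eq_square)
    then have mom0: "r\<^sup>2 * (\<rho> r * v r * v' r + k\<^sup>2 * (\<rho> r * l r)) + m * \<rho> r = 0"
      using momentum[OF r] by simp
    show ?thesis
      using DERIV_imp_deriv[OF flux_derivs(1)[OF \<rho>'[OF r] v'[OF r]]]
        DERIV_imp_deriv[OF flux_derivs(2)[OF \<rho>'[OF r] v'[OF r]], of k] mass0 mom0
      by simp
  qed
  then show ?thesis using I smooth pos init by (auto simp: steady_solution_def)
qed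

section \<open>The static solution\<close>

lemma static_solution:
  assumes "k > 0" "r0 > 0" "\<rho>0 > 0"
  shows "steady_solution k m r0 \<rho>0 0 {0<..} (\<lambda>r. \<rho>0 * exp (m / k\<^sup>2 * (1 / r - 1 / r0))) (\<lambda>r. 0)"
proof -
  let ?\<rho> = "\<lambda>r. \<rho>0 * exp (m / k\<^sup>2 * (1 / r - 1 / r0))"
  let ?l = "\<lambda>r. - m / k\<^sup>2 * (inverse r * inverse r)"
  have \<rho>': "(?\<rho> has_real_derivative ?\<rho> r * ?l r) (at r)" if "r \<in> {0<..}" for r
    using that \<open>k > 0\<close> by (auto intro!: derivative_eq_intros simp: power2_eq_square field_simps)
  have rat: "rational_in {0<..} ?\<rho> (\<lambda>r. ?\<rho> r * ?l r)"
    by (intro rational_in.mult rational_in.gen rational_in.const rational_in.inverse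
        rational_in.ident) auto
  show ?thesis
  proof (rule steady_solutionI[where l = ?l and v' = "\<lambda>r. 0"])
    show "smooth_on_open {0<..} ?\<rho>"
      by (rule smooth_on_open_rational[OF _ rat \<rho>' rational_in.gen]) auto
    show "smooth_on_open {0<..} (\<lambda>r::real. 0::real)"
      by (rule smooth_on_open_rational[OF _ rat \<rho>' rational_in.const]) auto
  qed (use assms \<rho>' in \<open>auto simp: is_interval_convex_1 field_simps power2_eq_square\<close>)
qed

lemma static_solution_unique:
  assumes "k > 0" "r0 > 0" "\<rho>0 > 0" and sol: "steady_solution k m r0 \<rho>0 0 J \<sigma> w" and "r \<in> J"
  shows "\<sigma> r = \<rho>0 * exp (m / k\<^sup>2 * (1 / r - 1 / r0))" "w r = 0"
proof -
  have pos: "r > 0" "\<sigma> r > 0" using sol \<open>r \<in> J\<close> by (auto simp: steady_solution_def)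
  show "w r = 0" using mass_flux_eq[OF sol \<open>r \<in> J\<close>] pos by auto
  then have "k\<^sup>2 * ln (\<sigma> r) = k\<^sup>2 * ln \<rho>0 + m * (1 / r - 1 / r0)"
    using bernoulli_eq[OF sol \<open>r \<in> J\<close>] by (simp add: algebra_simps)
  then have "ln (\<sigma> r) = ln \<rho>0 + m / k\<^sup>2 * (1 / r - 1 / r0)"
    using \<open>k > 0\<close> by (simp add: field_simps)
  then have "exp (ln (\<sigma> r)) = exp (ln \<rho>0) * exp (m / k\<^sup>2 * (1 / r - 1 / r0))"
    by (simp only: exp_add)
  then show "\<sigma> r = \<rho>0 * exp (m / k\<^sup>2 * (1 / r - 1 / r0))" using pos \<open>\<rho>0 > 0\<close> by simp
qed

section \<open>Moving solutions: the velocity as a branch of the kinetic well\<close>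

locale moving_gas =
  fixes k m r0 \<rho>0 v0 :: real
  assumes k: "k > 0" and m: "m > 0" and r0: "r0 > 0" and \<rho>0: "\<rho>0 > 0"
    and v0: "v0 > 0" "v0 \<noteq> k"
begin

interpretation K: potential_well "kinetic k" "\<lambda>v. v - k\<^sup>2 / v" k
  by (rule kinetic_well[OF k])

interpretation G: potential_well "potential k m" "\<lambda>r. 2 * k\<^sup>2 / r - m / r\<^sup>2" "m / (2 * k\<^sup>2)"
  by (rule potential_well_potential[OF k m])

text \<open>The value of \<open>potential\<close> at which the Bernoulli law forces \<open>v = k\<close>.\<close>

definition sonic_level :: real where
  "sonic_level = potential k m r0 - (kinetic k v0 - kinetic k k)"

text \<open>The value that the Bernoulli law prescribes for \<open>kinetic\<close> at radius \<open>r\<close>. Writing it relative to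
  \<open>sonic_level\<close> shows at once that it exceeds the minimum of \<open>kinetic\<close> exactly where \<open>potential\<close>
  exceeds \<open>sonic_level\<close>.\<close>

definition energy :: "real \<Rightarrow> real" where
  "energy r = kinetic k k + (potential k m r - sonic_level)"

definition velocity :: "real \<Rightarrow> real" where
  "velocity r = K.branch v0 (energy r)"

definition density :: "real \<Rightarrow> real" where
  "density r = r0\<^sup>2 * \<rho>0 * v0 / (r\<^sup>2 * velocity r)"

lemma energy_at_r0: "energy r0 = kinetic k v0"
  by (simp add: energy_def sonic_level_def)

lemma sonic_level_less: "sonic_level < potential k m r0"
  using K.above_minimum[OF v0] by (simp add: sonic_level_def)

lemma sonic_points_eq: "sonic_points k m r0 v0 = {r. r > 0 \<and> potential k m r = sonic_level}"
proof -
  have "1 / 2 * (k\<^sup>2 - v0\<^sup>2) + k\<^sup>2 * ln (v0 / k) - k\<^sup>2 * ln (r\<^sup>2 / r0\<^sup>2) - m / r + m / r0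
      = sonic_level - potential k m r" if "r > 0" for r
    using that k r0 v0
    by (simp add: sonic_level_def potential_def kinetic_def ln_div ln_realpow algebra_simps
        diff_divide_distrib)
  then show ?thesis by (auto simp: sonic_points_def)
qed

text \<open>The number \<open>P\<close> measures, in units of \<open>k\<^sup>2\<close>, how far the bottom of the potential well lies above
  the sonic level. Its constant \<open>3 / 2\<close> is \<open>2 - 1 / 2\<close>: the term \<open>m / r\<close> equals \<open>2 k\<^sup>2\<close> at the bottom of
  the well, and the quadratic term of \<open>- kinetic k\<close> is \<open>- k\<^sup>2 / 2\<close>.\<close>

lemma P_eq: "P k m r0 v0 = ereal ((potential k m (m / (2 * k\<^sup>2)) - sonic_level) / k\<^sup>2)"
proof -
  define L where "L = ln (m / (2 * k\<^sup>2))"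
  have "m\<^sup>2 / (4 * k ^ 3 * r0\<^sup>2 * v0) = (m / (2 * k\<^sup>2))\<^sup>2 * k / (r0\<^sup>2 * v0)"
    using k by (simp add: field_simps power2_eq_square power3_eq_cube)
  also have "ln \<dots> = 2 * ln (m / (2 * k\<^sup>2)) + ln k - ln (r0\<^sup>2 * v0)"
    using k m r0 v0 by (subst ln_div) (simp_all add: ln_mult ln_realpow)
  also have "\<dots> = 2 * L + ln k - 2 * ln r0 - ln v0"
    using r0 v0 by (simp add: L_def ln_mult ln_realpow)
  finally have log: "ln (m\<^sup>2 / (4 * k ^ 3 * r0\<^sup>2 * v0)) = 2 * L + ln k - 2 * ln r0 - ln v0" .
  have "potential k m (m / (2 * k\<^sup>2)) = 2 * k\<^sup>2 * L + 2 * k\<^sup>2"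
    using m by (simp add: potential_def L_def)
  then have "3 / 2 + (2 * L + ln k - 2 * ln r0 - ln v0) + 1 / (2 * k\<^sup>2) * (v0\<^sup>2 - 2 * m / r0)
      = (potential k m (m / (2 * k\<^sup>2)) - sonic_level) / k\<^sup>2"
    using k r0
    by (simp add: sonic_level_def kinetic_def potential_def[of k m r0] field_simps power2_eq_square)
  then show ?thesis using v0 log by (simp add: P_def)
qed

lemma P_le_0_iff: "P k m r0 v0 \<le> 0 \<longleftrightarrow> potential k m (m / (2 * k\<^sup>2)) \<le> sonic_level"
  and P_less_0_iff: "P k m r0 v0 < 0 \<longleftrightarrow> potential k m (m / (2 * k\<^sup>2)) < sonic_level"
  using k by (simp_all add: P_eq zero_ereal_def divide_le_0_iff divide_less_0_iff)

lemma any_solution: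
  assumes sol: "steady_solution k m r0 \<rho>0 v0 J \<sigma> w" and r: "r \<in> J"
  shows "w r > 0" "\<sigma> r = r0\<^sup>2 * \<rho>0 * v0 / (r\<^sup>2 * w r)" "kinetic k (w r) = energy r"
proof -
  have pos: "r > 0" "\<sigma> r > 0" using sol r by (auto simp: steady_solution_def)
  note flux = mass_flux_eq[OF sol r]
  have "r\<^sup>2 * \<sigma> r * w r > 0" using flux r0 \<rho>0 v0 by simp
  moreover have "r\<^sup>2 * \<sigma> r > 0" using pos by simp
  ultimately show w: "w r > 0" using zero_less_mult_pos by blast
  show "\<sigma> r = r0\<^sup>2 * \<rho>0 * v0 / (r\<^sup>2 * w r)"
    using flux pos w by (simp add: field_simps)
  have "ln (r\<^sup>2 * \<sigma> r * w r) = ln (r0\<^sup>2 * \<rho>0 * v0)" using flux by simp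
  then have ln_\<sigma>: "ln (\<sigma> r) = 2 * ln r0 + ln \<rho>0 + ln v0 - 2 * ln r - ln (w r)"
    using pos w r0 \<rho>0 v0 by (simp add: ln_mult ln_realpow)
  show "kinetic k (w r) = energy r"
    using bernoulli_eq[OF sol r, unfolded ln_\<sigma>]
    by (simp add: energy_def sonic_level_def kinetic_def potential_def algebra_simps)
qed

text \<open>Here the domain of a solution is limited: the kinetic term cannot go below its minimum, and
  attains it only at the sound speed.\<close>

lemma solution_level:
  assumes sol: "steady_solution k m r0 \<rho>0 v0 J \<sigma> w" and r: "r \<in> J"
  shows "sonic_level \<le> potential k m r" "w r \<noteq> k \<Longrightarrow> sonic_level < potential k m r"
  using K.minimum[of "w r"] K.above_minimum[of "w r"] any_solution[OF sol r]
  by (auto simp: energy_def)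

lemma velocity_props:
  assumes "sonic_level < potential k m r"
  shows "velocity r > 0" "sgn (velocity r - k) = sgn (v0 - k)" "velocity r \<noteq> k"
    "kinetic k (velocity r) = energy r"
proof -
  have "kinetic k k < energy r" using assms by (simp add: energy_def)
  then show "velocity r > 0" "sgn (velocity r - k) = sgn (v0 - k)"
      "kinetic k (velocity r) = energy r"
    using K.branch_in_side[OF v0(2)] K.f_branch[OF v0(2)] by (auto simp: velocity_def K.side_def)
  then show "velocity r \<noteq> k" using v0 by (auto simp: sgn_if split: if_splits)
qed

text \<open>Strictly above the sonic level the velocity cannot equal \<open>k\<close>, so on a connected set containing
  \<open>r0\<close> it stays on the side of \<open>v0\<close>, where the Bernoulli law has a single root.\<close>

lemma solution_eq_branch:
  assumes sol: "steady_solution k m r0 \<rho>0 v0 J \<sigma> w" and I: "is_interval I" "r0 \<in> I"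
    and above: "\<And>r. r \<in> I \<Longrightarrow> sonic_level < potential k m r"
    and r: "r \<in> J \<inter> I"
  shows "\<sigma> r = density r" "w r = velocity r"
proof -
  note sol' = sol[unfolded steady_solution_def]
  have J: "is_interval J" "r0 \<in> J" "w r0 = v0" using sol' by auto
  have not_k: "w s \<noteq> k" if "s \<in> J \<inter> I" for s
    using any_solution(3)[OF sol, of s] above[of s] that by (auto simp: energy_def)
  have "continuous_on J w"
  proof (intro continuous_at_imp_continuous_on ballI)
    fix s assume "s \<in> J"
    then have "(deriv ^^ 0) w differentiable (at s)"
      using sol' unfolding smooth_on_open_def by blast
    then show "isCont w s" by (simp add: differentiable_imp_continuous_within)
  qed
  moreover have "connected (J \<inter> I)"
    using J I by (auto intro: is_interval_connected is_interval_Int)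
  ultimately have conn: "connected (w ` (J \<inter> I))"
    by (intro connected_continuous_image) (auto intro: continuous_on_subset)
  have mem: "w r \<in> w ` (J \<inter> I)" "v0 \<in> w ` (J \<inter> I)" using r J I by force+
  have "k \<notin> w ` (J \<inter> I)" using not_k by auto
  then have "sgn (w r - k) = sgn (v0 - k)"
    using connectedD_interval[OF conn mem(1) mem(2), of k]
      connectedD_interval[OF conn mem(2) mem(1), of k] not_k[OF r] v0
    by (auto simp: sgn_if)
  then have "w r \<in> K.side v0"
    using any_solution(1)[OF sol, of r] r by (simp add: K.side_def)
  then show "w r = velocity r"
    using any_solution(3)[OF sol, of r] K.branch_f[OF v0(2), of "w r"] r
    by (simp add: velocity_def)
  then show "\<sigma> r = density r"
    using any_solution(2)[OF sol, of r] r by (auto simp: density_def)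
qed

text \<open>Differentiating the Bernoulli law gives \<open>(v - k\<^sup>2 / v) v' = 2 k\<^sup>2 / r - m / r\<^sup>2\<close>. Away from the
  sound speed this is a rational differential equation for the velocity, hence smoothness.\<close>

lemma branch_solution:
  assumes I: "open I" "is_interval I" "I \<subseteq> {0<..}" "r0 \<in> I"
    and above: "\<And>r. r \<in> I \<Longrightarrow> sonic_level < potential k m r"
  shows "steady_solution k m r0 \<rho>0 v0 I density velocity"
proof -
  let ?q = "r0\<^sup>2 * \<rho>0 * v0"
  let ?v' = "\<lambda>r. inverse (velocity r + (- (k\<^sup>2)) * inverse (velocity r)) *
               (2 * k\<^sup>2 * inverse r + (- m) * (inverse r * inverse r))"
  let ?l = "\<lambda>r. - 2 / r - ?v' r / velocity r"
  have pos: "r > 0" "velocity r > 0" "velocity r \<noteq> k"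
    if "r \<in> I" for r using velocity_props above I that by auto
  \<comment> \<open>\<open>?v'\<close> is spelled with sums, products and \<open>inverse\<close> only, to match the generators of
    \<open>rational_in\<close>.\<close>
  have nz: "velocity r + (- (k\<^sup>2)) * inverse (velocity r) \<noteq> 0" if "r \<in> I" for r
    using K.deriv_nonzero[OF pos(2,3)[OF that]] by (simp add: divide_inverse)
  have v': "(velocity has_real_derivative ?v' r) (at r)" if "r \<in> I" for r
  proof -
    have "(energy has_real_derivative 2 * k\<^sup>2 / r - m / r\<^sup>2) (at r)"
      unfolding energy_def[abs_def] using potential_deriv[OF pos(1)[OF that], of k m]
      by (auto intro!: derivative_eq_intros)
    moreover have "kinetic k k < energy r" using above[OF that] by (simp add: energy_def)
    ultimately have "((\<lambda>r. K.branch v0 (energy r)) has_real_derivative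
        inverse (velocity r - k\<^sup>2 / velocity r) * (2 * k\<^sup>2 / r - m / r\<^sup>2)) (at r)"
      using K.branch_deriv[OF v0(2), of "energy r"] unfolding velocity_def
      by (intro DERIV_chain2)
    then show ?thesis
      unfolding velocity_def[abs_def] by (simp add: divide_inverse power2_eq_square)
  qed
  have rat_v': "rational_in I velocity ?v'"
    by (intro rational_in.intros ballI nz) (use pos in force)+
  have "rational_in I velocity (\<lambda>r. ?q * inverse (r * r * velocity r))"
    by (intro rational_in.intros ballI) (use pos in force)+
  then have rat_\<rho>: "rational_in I velocity density"
    by (simp add: density_def[abs_def] divide_inverse power2_eq_square)
  have init: "velocity r0 = v0"
    using K.branch_f[OF v0(2), of v0] v0 by (simp add: velocity_def energy_at_r0 K.side_def)
  show ?thesis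
  proof (rule steady_solutionI[OF I, where l = ?l and v' = ?v'])
    show "smooth_on_open I density"
      by (rule smooth_on_open_rational[OF \<open>open I\<close> rat_v' v' rat_\<rho>])
    show "smooth_on_open I velocity"
      by (rule smooth_on_open_rational[OF \<open>open I\<close> rat_v' v' rational_in.gen])
    show "density r > 0" if "r \<in> I" for r
      using pos[OF that] r0 \<rho>0 v0 by (simp add: density_def)
    show "density r0 = \<rho>0" using init r0 v0 by (simp add: density_def)
    fix r assume r: "r \<in> I"
    show "(density has_real_derivative density r * ?l r) (at r)"
    proof -
      define d where "d = ?v' r"
      have "(velocity has_real_derivative d) (at r)" using v'[OF r] by (simp add: d_def)
      then have "(density has_real_derivative density r * (- 2 / r - d / velocity r)) (at r)"
        unfolding density_def[abs_def] using pos[OF r]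
        by (auto intro!: derivative_eq_intros simp: field_simps power2_eq_square)
      then show ?thesis by (simp add: d_def)
    qed
    show "velocity r * (2 / r + ?l r) + ?v' r = 0" using pos[OF r] by simp
    have "(velocity r - k\<^sup>2 / velocity r) * ?v' r = 2 * k\<^sup>2 / r - m / r\<^sup>2"
      using nz[OF r] by (simp add: divide_inverse power2_eq_square)
    moreover have "velocity r * d + k\<^sup>2 * (- 2 / r - d / velocity r) + m / r\<^sup>2
        = (velocity r - k\<^sup>2 / velocity r) * d - (2 * k\<^sup>2 / r - m / r\<^sup>2)" for d
      by (simp add: algebra_simps)
    ultimately show "velocity r * ?v' r + k\<^sup>2 * ?l r + m / r\<^sup>2 = 0" by simp
  qed (use v' init in auto)
qed

lemma tendsto_sound_speed:
  assumes "s > 0" "potential k m s = sonic_level"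
    and "eventually (\<lambda>r. sonic_level < potential k m r) (at s within S)"
  shows "(velocity \<longlongrightarrow> k) (at s within S)"
proof (rule K.tendsto_minimum)
  show "eventually (\<lambda>r. velocity r > 0) (at s within S)"
    using assms(3) by eventually_elim (rule velocity_props)
  have "isCont (potential k m) s"
    using potential_deriv[OF \<open>s > 0\<close>] DERIV_isCont by blast
  then have "(potential k m \<longlongrightarrow> sonic_level) (at s within S)"
    using assms(2) continuous_within continuous_at_imp_continuous_at_within by metis
  then have "(energy \<longlongrightarrow> kinetic k k + (sonic_level - sonic_level)) (at s within S)"
    unfolding energy_def[abs_def] by (intro tendsto_intros)
  then have "(energy \<longlongrightarrow> kinetic k k) (at s within S)" by simp
  moreover have "eventually (\<lambda>r. energy r = kinetic k (velocity r)) (at s within S)"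
    using assms(3) by eventually_elim (rule velocity_props(4)[symmetric])
  ultimately show "((\<lambda>r. kinetic k (velocity r)) \<longlongrightarrow> kinetic k k) (at s within S)"
    using tendsto_cong by fastforce
qed

text \<open>An open domain containing a sonic point would also contain radii just inside the gap, where
  the potential is below the sonic level. If the gap is empty (\<open>a = b\<close>), the solution would at
  least have to pass the sonic point with \<open>v = k\<close>.\<close>

lemma sonic_points_not_in_domain:
  assumes sol: "steady_solution k m r0 \<rho>0 v0 J \<sigma> w"
    and ab: "0 < a" "a \<le> b" "potential k m a = sonic_level" "potential k m b = sonic_level"
      "\<And>x. a < x \<Longrightarrow> x < b \<Longrightarrow> potential k m x < sonic_level"
    and proper: "a < b \<or> (\<forall>r\<in>J. w r \<noteq> k)"
  shows "a \<notin> J" "b \<notin> J"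
proof -
  have "open J" using sol by (simp add: steady_solution_def)
  have no_dip: "\<not> (a < x \<and> x < b)" if "x \<in> J" for x
    using solution_level(1)[OF sol that] ab(5)[of x] by auto
  show "a \<notin> J"
  proof
    assume a: "a \<in> J"
    then have "a < b" using proper solution_level(2)[OF sol a] ab by auto
    obtain e where "e > 0" and e: "\<And>y. dist y a < e \<Longrightarrow> y \<in> J"
      using \<open>open J\<close> a unfolding open_dist by blast
    define d where "d = min e (b - a) / 2"
    have "0 < d" "d < e" "d < b - a" using \<open>e > 0\<close> \<open>a < b\<close> by (auto simp: d_def min_def)
    moreover have "a + d \<in> J" by (rule e) (use \<open>0 < d\<close> \<open>d < e\<close> in \<open>simp add: dist_real_def\<close>)
    ultimately show False using no_dip[of "a + d"] by auto
  qed
  show "b \<notin> J"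
  proof
    assume b: "b \<in> J"
    then have "a < b" using proper solution_level(2)[OF sol b] ab by auto
    obtain e where "e > 0" and e: "\<And>y. dist y b < e \<Longrightarrow> y \<in> J"
      using \<open>open J\<close> b unfolding open_dist by blast
    define d where "d = min e (b - a) / 2"
    have "0 < d" "d < e" "d < b - a" using \<open>e > 0\<close> \<open>a < b\<close> by (auto simp: d_def min_def)
    moreover have "b - d \<in> J" by (rule e) (use \<open>0 < d\<close> \<open>d < e\<close> in \<open>simp add: dist_real_def\<close>)
    ultimately show False using no_dip[of "b - d"] by auto
  qed
qed

lemma global_regime:
  assumes "P k m r0 v0 > 0" "r > 0"
  shows "sonic_level < potential k m r"
  using assms G.minimum[of r] P_le_0_iff by (meson le_less_trans not_le)

text \<open>A solution domain is an interval that contains \<open>r0\<close> and misses both sonic points, so it stays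
  on the side of the gap where \<open>r0\<close> lies. The gap surrounds the bottom of the well, which
  is why comparing \<open>r0\<close> with \<open>m / (2 k\<^sup>2)\<close> decides which side that is.\<close>

lemma sonic_regime:
  assumes "P k m r0 v0 \<le> 0"
  obtains rlo rhi where "rlo \<le> rhi" "sonic_points k m r0 v0 = {rlo, rhi}"
    "open (sonic_domain k m r0 rlo rhi)" "is_interval (sonic_domain k m r0 rlo rhi)"
    "sonic_domain k m r0 rlo rhi \<subset> {0<..}" "r0 \<in> sonic_domain k m r0 rlo rhi"
    "\<And>r. r \<in> sonic_domain k m r0 rlo rhi \<Longrightarrow> sonic_level < potential k m r"
    "\<And>J \<sigma> w. steady_solution k m r0 \<rho>0 v0 J \<sigma> w \<Longrightarrow>
       P k m r0 v0 \<noteq> 0 \<or> (\<forall>r\<in>J. w r \<noteq> k) \<Longrightarrow> J \<subseteq> sonic_domain k m r0 rlo rhi"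
    "if r0 \<le> m / (2 * k\<^sup>2) then (velocity \<longlongrightarrow> k) (at_left rlo)
     else (velocity \<longlongrightarrow> k) (at_right rhi)"
proof -
  have low: "potential k m (m / (2 * k\<^sup>2)) \<le> sonic_level" using assms by (simp add: P_le_0_iff)
  obtain a b where ab: "0 < a" "a \<le> m / (2 * k\<^sup>2)" "m / (2 * k\<^sup>2) \<le> b"
      "potential k m a = sonic_level" "potential k m b = sonic_level"
    and outside: "\<And>x. x > 0 \<Longrightarrow> sonic_level < potential k m x \<longleftrightarrow> x < a \<or> b < x"
    and inside: "\<And>x. a < x \<Longrightarrow> x < b \<Longrightarrow> potential k m x < sonic_level"
    using G.level_set[OF low] by metis
  let ?I = "sonic_domain k m r0 a b"
  have "a \<le> b" using ab by simp
  have r0_side: "r0 < a \<or> b < r0" using outside[OF r0] sonic_level_less by simp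
  have points: "sonic_points k m r0 v0 = {a, b}"
  proof -
    have "x = a \<or> x = b" if "x > 0" "potential k m x = sonic_level" for x
      using outside[of x] inside[of x] that by force
    then show ?thesis using ab by (auto simp: sonic_points_eq)
  qed
  have r0_in: "r0 \<in> ?I" using r0_side ab r0 by (auto simp: sonic_domain_def)
  have maximal: "J \<subseteq> ?I" if sol: "steady_solution k m r0 \<rho>0 v0 J \<sigma> w"
      and proper: "P k m r0 v0 \<noteq> 0 \<or> (\<forall>r\<in>J. w r \<noteq> k)" for J \<sigma> w
  proof
    fix x assume x: "x \<in> J"
    have J: "is_interval J" "J \<subseteq> {0<..}" "r0 \<in> J" using sol by (auto simp: steady_solution_def)
    have "a < b" if "P k m r0 v0 \<noteq> 0"
    proof -
      have "potential k m (m / (2 * k\<^sup>2)) < sonic_level"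
        using that assms P_less_0_iff by (simp add: less_le)
      then have "a \<noteq> m / (2 * k\<^sup>2)" using ab by auto
      then show ?thesis using ab by simp
    qed
    then have "a < b \<or> (\<forall>r\<in>J. w r \<noteq> k)" using proper by auto
    then have ends: "a \<notin> J" "b \<notin> J"
      using sonic_points_not_in_domain[OF sol ab(1) \<open>a \<le> b\<close> ab(4,5) inside] by auto
    have between: "z \<in> J" if "r0 \<le> z \<and> z \<le> x \<or> x \<le> z \<and> z \<le> r0" for z
      using that J x mem_is_interval_1_I by metis
    show "x \<in> ?I"
      using between[of a] between[of b] ends r0_side J x ab
      by (auto simp: sonic_domain_def subset_iff) (metis not_le)+
  qed
  have above: "sonic_level < potential k m r" if "r \<in> ?I" for r
    using that outside[of r] ab by (auto simp: sonic_domain_def split: if_splits)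
  have limit: "if r0 \<le> m / (2 * k\<^sup>2) then (velocity \<longlongrightarrow> k) (at_left a)
     else (velocity \<longlongrightarrow> k) (at_right b)"
  proof (cases "r0 \<le> m / (2 * k\<^sup>2)")
    case True
    have "eventually (\<lambda>r. r \<in> {0<..<a}) (at_left a)"
      by (rule eventually_at_left_real) (use ab in simp)
    then have "eventually (\<lambda>r. sonic_level < potential k m r) (at_left a)"
      by eventually_elim (use outside in auto)
    then show ?thesis using tendsto_sound_speed ab True by simp
  next
    case False
    have "eventually (\<lambda>r. r \<in> {b<..<b+1}) (at_right b)"
      by (rule eventually_at_right_real) simp
    then have "eventually (\<lambda>r. sonic_level < potential k m r) (at_right b)"
      by eventually_elim (use outside ab in auto)
    then show ?thesis using tendsto_sound_speed[of b "{b<..}"] ab False by simp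
  qed
  have "a \<notin> ?I" "?I \<subseteq> {0<..}" using ab by (auto simp: sonic_domain_def)
  then have "?I \<subset> {0<..}" using ab by auto
  moreover have "open ?I" "is_interval ?I"
    by (auto simp: sonic_domain_def is_interval_convex_1)
  ultimately show ?thesis
    using that[of a b] \<open>a \<le> b\<close> points r0_in above maximal limit by blast
qed

end

section \<open>Existence, uniqueness and domain of the steady flow\<close>

theorem theorem4p7:
  fixes k m r0 \<rho>0 v0 :: real
  assumes "k > 0" and "m > 0" and "r0 > 0" and "\<rho>0 > 0" and "v0 \<ge> 0" and "v0 \<noteq> k"
  shows "\<exists>I \<rho> v.
    steady_solution k m r0 \<rho>0 v0 I \<rho> v \<and>
    (\<forall>J \<sigma> w. steady_solution k m r0 \<rho>0 v0 J \<sigma> w \<longrightarrow>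
       (\<forall>r\<in>J \<inter> I. \<sigma> r = \<rho> r \<and> w r = v r) \<and>
       (P k m r0 v0 \<noteq> 0 \<or> (\<forall>r\<in>J. w r \<noteq> k) \<longrightarrow> J \<subseteq> I)) \<and>
    (\<forall>r\<in>I. sgn (v r - k) = sgn (v0 - k)) \<and>
    (P k m r0 v0 > 0 \<longrightarrow> I = {0<..}) \<and>
    (P k m r0 v0 \<le> 0 \<longrightarrow>
       (\<exists>rlo rhi. rlo \<le> rhi \<and> sonic_points k m r0 v0 = {rlo, rhi} \<and>
          I = sonic_domain k m r0 rlo rhi \<and> I \<subset> {0<..} \<and>
          (if r0 \<le> m / (2 * k\<^sup>2)
           then (v \<longlongrightarrow> k) (at_left rlo)
           else (v \<longlongrightarrow> k) (at_right rhi))))"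
proof (cases "v0 = 0")
  case True
  let ?\<rho> = "\<lambda>r. \<rho>0 * exp (m / k\<^sup>2 * (1 / r - 1 / r0))"
  have P: "P k m r0 v0 > 0" using True by (simp add: P_def)
  show ?thesis
  proof (rule exI[of _ "{0<..}"], rule exI[of _ ?\<rho>], rule exI[of _ "\<lambda>r. 0"],
      intro conjI allI impI ballI)
    show "steady_solution k m r0 \<rho>0 v0 {0<..} ?\<rho> (\<lambda>r. 0)"
      using static_solution[of k r0 \<rho>0 m] assms True by simp
    fix J \<sigma> w assume sol: "steady_solution k m r0 \<rho>0 v0 J \<sigma> w"
    show "\<sigma> r = ?\<rho> r" "w r = 0" if "r \<in> J \<inter> {0<..}" for r
      using static_solution_unique[of k r0 \<rho>0 m J \<sigma> w r] sol that assms True by auto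
    show "J \<subseteq> {0<..}" using sol by (simp add: steady_solution_def)
  qed (use P True in auto)
next
  case False
  then interpret moving_gas k m r0 \<rho>0 v0 using assms by unfold_locales auto
  show ?thesis
  proof (cases "P k m r0 v0 \<le> 0")
    case True
    obtain rlo rhi where points: "rlo \<le> rhi" "sonic_points k m r0 v0 = {rlo, rhi}"
      and I: "open (sonic_domain k m r0 rlo rhi)" "is_interval (sonic_domain k m r0 rlo rhi)"
        "sonic_domain k m r0 rlo rhi \<subset> {0<..}" "r0 \<in> sonic_domain k m r0 rlo rhi"
      and above: "\<And>r. r \<in> sonic_domain k m r0 rlo rhi \<Longrightarrow> sonic_level < potential k m r"
      and maximal: "\<And>J \<sigma> w. steady_solution k m r0 \<rho>0 v0 J \<sigma> w \<Longrightarrow>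
        P k m r0 v0 \<noteq> 0 \<or> (\<forall>r\<in>J. w r \<noteq> k) \<Longrightarrow> J \<subseteq> sonic_domain k m r0 rlo rhi"
      and limit: "if r0 \<le> m / (2 * k\<^sup>2) then (velocity \<longlongrightarrow> k) (at_left rlo)
        else (velocity \<longlongrightarrow> k) (at_right rhi)"
      by (rule sonic_regime[OF True], rule that)
    show ?thesis
    proof (rule exI[of _ "sonic_domain k m r0 rlo rhi"], rule exI[of _ density],
        rule exI[of _ velocity], intro conjI allI impI ballI)
      show "steady_solution k m r0 \<rho>0 v0 (sonic_domain k m r0 rlo rhi) density velocity"
        by (rule branch_solution[OF I(1,2) psubset_imp_subset[OF I(3)] I(4) above])
      show "sgn (velocity r - k) = sgn (v0 - k)" if "r \<in> sonic_domain k m r0 rlo rhi" for r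
        by (rule velocity_props(2)[OF above[OF that]])
      show "sonic_domain k m r0 rlo rhi = {0<..}" if "P k m r0 v0 > 0"
        using True that by simp
      show "\<exists>rlo' rhi'. rlo' \<le> rhi' \<and> sonic_points k m r0 v0 = {rlo', rhi'} \<and>
          sonic_domain k m r0 rlo rhi = sonic_domain k m r0 rlo' rhi' \<and>
          sonic_domain k m r0 rlo rhi \<subset> {0<..} \<and>
          (if r0 \<le> m / (2 * k\<^sup>2)
           then (velocity \<longlongrightarrow> k) (at_left rlo')
           else (velocity \<longlongrightarrow> k) (at_right rhi'))"
        by (rule exI[of _ rlo], rule exI[of _ rhi]) (intro conjI points I(3) refl limit)
    next
      fix J \<sigma> w assume sol: "steady_solution k m r0 \<rho>0 v0 J \<sigma> w"
      show "\<sigma> r = density r" "w r = velocity r" if "r \<in> J \<inter> sonic_domain k m r0 rlo rhi" for r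
        by (rule solution_eq_branch[OF sol I(2,4) above that]; assumption)+
      show "J \<subseteq> sonic_domain k m r0 rlo rhi"
        if "P k m r0 v0 \<noteq> 0 \<or> (\<forall>r\<in>J. w r \<noteq> k)"
        by (rule maximal[OF sol that])
    qed
  next
    case False
    then have above: "sonic_level < potential k m r" if "r \<in> {0<..}" for r
      using global_regime that by auto
    have I: "open {0::real<..}" "is_interval {0::real<..}" "r0 \<in> {0<..}"
      using assms by (auto simp: is_interval_convex_1)
    show ?thesis
    proof (rule exI[of _ "{0<..}"], rule exI[of _ density], rule exI[of _ velocity],
        intro conjI allI impI ballI)
      show "steady_solution k m r0 \<rho>0 v0 {0<..} density velocity"
        by (rule branch_solution[OF I(1,2) subset_refl I(3) above])
      show "sgn (velocity r - k) = sgn (v0 - k)" if "r \<in> {0<..}" for r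
        by (rule velocity_props(2)[OF above[OF that]])
    next
      fix J \<sigma> w assume sol: "steady_solution k m r0 \<rho>0 v0 J \<sigma> w"
      show "\<sigma> r = density r" "w r = velocity r" if "r \<in> J \<inter> {0<..}" for r
        by (rule solution_eq_branch[OF sol I(2,3) above that]; assumption)+
      show "J \<subseteq> {0<..}" using sol by (simp add: steady_solution_def)
    qed (use False in auto)
  qed
qed

end
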